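(* Let $X$ be a geodesic metric space. For any $R>0$ there exist a $\sqrt R$-dense subset $S(R)\subset B_X(R)$, a tree $T(R)$ and a $(\sqrt R,\sqrt R,\sqrt R,\sqrt R)$-quasi-isometric embedding $f_R:S(R)\to T(R)$.
   Context: $B_X(R)$ is the ball of radius $R$ in $X$ centred at a fixed base point. A subset $S\subset B$ is $r$-dense if every point of $B$ is at distance at most $r$ from $S$. A tree is a metric tree (with its path metric); its vertices may have arbitrary degree, depending on $R$. A map $f:E\to F$ between metric spaces is a $(\lambda_1,c_1,\lambda_2,c_2)$-quasi-isometric embedding if for all $x,y\in E$, $\frac1{\lambda_2}(d(x,y)-c_2)\le d(f(x),f(y))\le\lambda_1d(x,y)+c_1$; here all four constants equal $\sqrt R$. *)

theory Defs
  imports "HOL-Analysis.Analysis"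
begin

definition geodesic_space :: "'a::metric_space itself \<Rightarrow> bool" where
  "geodesic_space _ \<longleftrightarrow>
    (\<forall>x y :: 'a. \<exists>\<gamma> :: real \<Rightarrow> 'a. \<gamma> 0 = x \<and> \<gamma> (dist x y) = y \<and>
      (\<forall>s\<in>{0..dist x y}. \<forall>t\<in>{0..dist x y}. dist (\<gamma> s) (\<gamma> t) = \<bar>s - t\<bar>))"

definition dense_subset :: "real \<Rightarrow> 'a::metric_space set \<Rightarrow> 'a set \<Rightarrow> bool" where
  "dense_subset r S B \<longleftrightarrow> S \<subseteq> B \<and> (\<forall>x\<in>B. \<exists>s\<in>S. dist x s \<le> r)"

definition qi_embedding ::
  "real \<Rightarrow> real \<Rightarrow> real \<Rightarrow> real \<Rightarrow>
   'a set \<Rightarrow> ('a \<Rightarrow> 'a \<Rightarrow> real) \<Rightarrow> 'b set \<Rightarrow> ('b \<Rightarrow> 'b \<Rightarrow> real) \<Rightarrow> ('a \<Rightarrow> 'b) \<Rightarrow> bool" where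
  "qi_embedding l1 c1 l2 c2 E dE F dF f \<longleftrightarrow>
    Metric_space E dE \<and> Metric_space F dF \<and> f ` E \<subseteq> F \<and>
    (\<forall>x\<in>E. \<forall>y\<in>E. 1 / l2 * (dE x y - c2) \<le> dF (f x) (f y) \<and>
                 dF (f x) (f y) \<le> l1 * dE x y + c1)"

text \<open>Combinatorial trees: simple graphs (edges are two-element vertex sets, vertex
  degrees and cardinality unrestricted) in which any two vertices are joined by exactly
  one path without repeated vertices.\<close>

definition simple_path :: "'v set \<Rightarrow> 'v set set \<Rightarrow> 'v \<Rightarrow> 'v \<Rightarrow> 'v list \<Rightarrow> bool" where
  "simple_path V E u v p \<longleftrightarrow>
    p \<noteq> [] \<and> hd p = u \<and> last p = v \<and> set p \<subseteq> V \<and> distinct p \<and>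
    (\<forall>i. Suc i < length p \<longrightarrow> {p ! i, p ! Suc i} \<in> E)"

definition combinatorial_tree :: "'v set \<Rightarrow> 'v set set \<Rightarrow> bool" where
  "combinatorial_tree V E \<longleftrightarrow>
    V \<noteq> {} \<and> (\<forall>e\<in>E. e \<subseteq> V \<and> card e = 2) \<and>
    (\<forall>u\<in>V. \<forall>v\<in>V. \<exists>!p. simple_path V E u v p)"

text \<open>A metric tree is the geometric realization of a combinatorial tree whose edges carry
  positive lengths, with the path metric. Points of the realization are given by their
  barycentric coordinates: the vertex \<open>v\<close> is \<open>indicator {v}\<close>, and the closed edge \<open>{u, v}\<close>
  consists of the functions \<open>p \<ge> 0\<close> supported on \<open>{u, v}\<close> with \<open>p u + p v = 1\<close>.\<close>

definition metric_tree :: "'v set \<Rightarrow> 'v set set \<Rightarrow> ('v set \<Rightarrow> real) \<Rightarrow> bool" where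
  "metric_tree V E len \<longleftrightarrow> combinatorial_tree V E \<and> (\<forall>e\<in>E. len e > 0)"

definition closed_edge :: "'v set \<Rightarrow> ('v \<Rightarrow> real) set" where
  "closed_edge e = {p. (\<forall>w. 0 \<le> p w) \<and> (\<forall>w. w \<notin> e \<longrightarrow> p w = 0) \<and> (\<Sum>w\<in>e. p w) = 1}"

definition tree_points :: "'v set \<Rightarrow> 'v set set \<Rightarrow> ('v \<Rightarrow> real) set" where
  "tree_points V E = (\<lambda>v. indicator {v}) ` V \<union> (\<Union>e\<in>E. closed_edge e)"

text \<open>On an edge \<open>e = {u, v}\<close> the two summands below are equal, so this is
  \<open>len e * \<bar>p u - q u\<bar>\<close>: the edge is isometric to the interval \<open>[0, len e]\<close>.\<close>

definition edge_dist :: "('v set \<Rightarrow> real) \<Rightarrow> 'v set \<Rightarrow> ('v \<Rightarrow> real) \<Rightarrow> ('v \<Rightarrow> real) \<Rightarrow> real" where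
  "edge_dist len e p q = len e * (\<Sum>w\<in>e. \<bar>p w - q w\<bar>) / 2"

text \<open>\<open>pl_path V E len p q L\<close>: there is a piecewise linear path of length \<open>L\<close> from \<open>p\<close> to
  \<open>q\<close>, each linear piece of which runs inside a single closed edge.\<close>

inductive pl_path ::
  "'v set \<Rightarrow> 'v set set \<Rightarrow> ('v set \<Rightarrow> real) \<Rightarrow> ('v \<Rightarrow> real) \<Rightarrow> ('v \<Rightarrow> real) \<Rightarrow> real \<Rightarrow> bool"
  for V E len where
  const: "p \<in> tree_points V E \<Longrightarrow> pl_path V E len p p 0"
| step: "pl_path V E len p q L \<Longrightarrow> e \<in> E \<Longrightarrow> q \<in> closed_edge e \<Longrightarrow> r \<in> closed_edge e \<Longrightarrow>
    pl_path V E len p r (L + edge_dist len e q r)"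

text \<open>The value \<open>0\<close> outside the tree is irrelevant, but \<open>Metric_space\<close> demands nonnegativity and
  symmetry for all arguments, including those outside the carrier.\<close>

definition path_dist ::
  "'v set \<Rightarrow> 'v set set \<Rightarrow> ('v set \<Rightarrow> real) \<Rightarrow> ('v \<Rightarrow> real) \<Rightarrow> ('v \<Rightarrow> real) \<Rightarrow> real" where
  "path_dist V E len p q =
    (if p \<in> tree_points V E \<and> q \<in> tree_points V E then Inf {L. pl_path V E len p q L} else 0)"

end

theory Submission
  imports Defs
begin

text \<open>
  The constants are so generous that a star suffices. Put \<open>r = sqrt R\<close> and let \<open>S\<close> be a maximal
  \<open>r\<close>-separated subset of the ball; by maximality it is \<open>r\<close>-dense (\<open>maximal_separated_subset\<close>).
  Distances between distinct points of \<open>S\<close> lie between \<open>r\<close> and \<open>2 * R = 2 * r\<^sup>2\<close>. Hence the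
  lower bound required of the distance between their images is at most
  \<open>(2 * r\<^sup>2 - r) / r = 2 * r - 1\<close>, and the upper bound is at least \<open>r\<^sup>2 + r\<close>. Since
  \<open>2 * r - 1 \<le> r\<^sup>2\<close>, the single value \<open>r\<^sup>2 = R\<close> meets both bounds for every pair. So
  \<open>S\<close> may be mapped bijectively onto the leaves of a star all of whose edges have length
  \<open>R / 2\<close>: any two distinct leaves are then at distance \<open>R\<close> (\<open>path_dist_star_leaves\<close>).

  What remains is to compute with the path metric, an infimum over piecewise linear paths. Lower
  bounds come from functions that are 1-Lipschitz on every edge, because the variation of such a
  function along a path is at most the length of the path (\<open>pl_path_lipschitz\<close>). Applied to
  rescaled barycentric coordinates this shows that distinct points have positive distance
  (\<open>Metric_space_path_dist\<close>); applied to the difference of the coordinates of two leaves it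
  shows that no path between these leaves is shorter than the one through the centre.
\<close>

section \<open>Maximal separated sets\<close>

text \<open>By Zorn's lemma: being \<open>r\<close>-separated only concerns pairs of points, so it passes to unions of
  chains. A point at distance more than \<open>r\<close> from a maximal \<open>r\<close>-separated set could be added to it.\<close>

lemma maximal_separated_subset:
  fixes B :: "'a::metric_space set"
  assumes "0 \<le> r"
  obtains S where "pairwise (\<lambda>x y. r \<le> dist x y) S" "dense_subset r S B"
proof -
  let ?A = "{S. S \<subseteq> B \<and> pairwise (\<lambda>x y. r \<le> dist x y) S}"
  have "\<Union>C \<in> ?A" if C: "subset.chain ?A C" for C
  proof -
    have "pairwise (\<lambda>x y. r \<le> dist x y) (\<Union>C)"
    proof (rule pairwiseI)
      fix x y assume "x \<in> \<Union>C" "y \<in> \<Union>C" "x \<noteq> y"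
      then obtain X Y where XY: "X \<in> C" "Y \<in> C" "x \<in> X" "y \<in> Y" by blast
      then have "X \<subseteq> Y \<or> Y \<subseteq> X" using C by (auto simp: subset_chain_def)
      then obtain Z where "Z \<in> C" "x \<in> Z" "y \<in> Z" using XY by blast
      then show "r \<le> dist x y"
        using C \<open>x \<noteq> y\<close> by (auto simp: subset_chain_def pairwise_def)
    qed
    then show ?thesis using C by (auto simp: subset_chain_def)
  qed
  from subset_Zorn'[OF this]
  obtain S where S: "S \<in> ?A" and max: "\<forall>X\<in>?A. S \<subseteq> X \<longrightarrow> X = S"
    by (rule bexE)
  have "\<exists>s\<in>S. dist x s \<le> r" if "x \<in> B" for x
  proof (rule ccontr)
    assume far: "\<not> (\<exists>s\<in>S. dist x s \<le> r)"
    then have "insert x S \<in> ?A"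
      using S that by (auto simp: pairwise_insert dist_commute not_le intro: less_imp_le)
    with max have "insert x S = S" by blast
    then have "x \<in> S" by blast
    with far \<open>0 \<le> r\<close> show False by auto
  qed
  then show thesis using S that by (auto simp: dense_subset_def)
qed

section \<open>The path metric of a metric graph\<close>

lemma edge_dist_commute: "edge_dist len e p q = edge_dist len e q p"
  by (simp add: edge_dist_def abs_minus_commute)

lemma edge_dist_eq_coordinate:
  assumes "card e = 2" "p \<in> closed_edge e" "q \<in> closed_edge e" "w \<in> e"
  shows "edge_dist len e p q = len e * \<bar>p w - q w\<bar>"
proof -
  obtain v where "v \<noteq> w" and e: "e = {w, v}"
    using assms(1,4) by (metis card_2_iff insert_commute insert_iff singletonD)
  then have "p v = 1 - p w" "q v = 1 - q w"
    using assms(2,3) by (auto simp: closed_edge_def)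
  with \<open>v \<noteq> w\<close> show ?thesis by (simp add: edge_dist_def e abs_minus_commute)
qed

lemma indicator_vertex_in_closed_edge:
  assumes "finite e" "v \<in> e"
  shows "indicator {v} \<in> closed_edge e"
  using assms by (auto simp: closed_edge_def indicator_def)

lemma pl_path_tree_points:
  assumes "pl_path V E len p q L"
  shows "p \<in> tree_points V E" "q \<in> tree_points V E"
  using assms by induction (auto simp: tree_points_def)

lemma pl_path_edge:
  assumes "e \<in> E" "p \<in> closed_edge e" "q \<in> closed_edge e"
  shows "pl_path V E len p q (edge_dist len e p q)"
proof -
  have "p \<in> tree_points V E" using assms by (auto simp: tree_points_def)
  from pl_path.step[OF pl_path.const[OF this] assms] show ?thesis by simp
qed

lemma pl_path_trans:
  assumes "pl_path V E len q r M" "pl_path V E len p q L"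
  shows "pl_path V E len p r (L + M)"
  using assms
proof induction
  case (step q r M e s)
  have "pl_path V E len p s ((L + M) + edge_dist len e r s)"
    by (rule pl_path.step) (use step in auto)
  then show ?case by (simp add: add.assoc)
qed simp

lemma pl_path_sym:
  assumes "pl_path V E len p q L"
  shows "pl_path V E len q p L"
  using assms
proof induction
  case (step p q L e r)
  have "pl_path V E len r q (edge_dist len e q r)"
    using pl_path_edge[OF step.hyps(2,4,3)] by (simp add: edge_dist_commute)
  from pl_path_trans[OF step.IH this] show ?case by (simp add: add.commute)
qed (rule pl_path.const)

lemma pl_path_lipschitz:
  fixes h :: "('v \<Rightarrow> real) \<Rightarrow> real"
  assumes "pl_path V E len p q L"
    and "\<And>e p q. e \<in> E \<Longrightarrow> p \<in> closed_edge e \<Longrightarrow> q \<in> closed_edge e \<Longrightarrow>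
           \<bar>h p - h q\<bar> \<le> edge_dist len e p q"
  shows "\<bar>h p - h q\<bar> \<le> L"
  using assms(1)
proof induction
  case (step p q L e r)
  then show ?case using assms(2)[of e q r] by linarith
qed simp

text \<open>The lengths are bounded below so that paths along ever shorter edges cannot make the distance
  of two points vanish: every barycentric coordinate, multiplied by the bound \<open>c\<close>, is then
  1-Lipschitz. The remaining axioms hold because paths can be reversed and concatenated.\<close>

lemma Metric_space_path_dist:
  assumes card: "\<And>e. e \<in> E \<Longrightarrow> card e = 2"
    and "0 < c" and len: "\<And>e. e \<in> E \<Longrightarrow> c \<le> len e"
    and conn: "\<And>p q. p \<in> tree_points V E \<Longrightarrow> q \<in> tree_points V E \<Longrightarrow> \<exists>L. pl_path V E len p q L"
  shows "Metric_space (tree_points V E) (path_dist V E len)"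
proof -
  let ?T = "tree_points V E" and ?d = "path_dist V E len"
  have coord: "c * \<bar>p w - q w\<bar> \<le> L" if "pl_path V E len p q L" for p q L w
  proof -
    have scale: "\<bar>c * a - c * b\<bar> = c * \<bar>a - b\<bar>" for a b
      using \<open>0 < c\<close> by (simp add: abs_mult flip: right_diff_distrib)
    have "c * \<bar>p w - q w\<bar> \<le> edge_dist len e p q"
      if e: "e \<in> E" "p \<in> closed_edge e" "q \<in> closed_edge e" for e p q
    proof (cases "w \<in> e")
      case True
      have "c * \<bar>p w - q w\<bar> \<le> len e * \<bar>p w - q w\<bar>"
        using len e by (intro mult_right_mono) auto
      also have "\<dots> = edge_dist len e p q"
        by (rule edge_dist_eq_coordinate[OF card[OF e(1)] e(2,3) True, symmetric])
      finally show ?thesis .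
    next
      case False
      then have "p w = 0" "q w = 0" using e by (auto simp: closed_edge_def)
      then show ?thesis
        using len[OF e(1)] \<open>0 < c\<close> by (simp add: edge_dist_def sum_nonneg)
    qed
    then show ?thesis
      using pl_path_lipschitz[OF that, of "\<lambda>p. c * p w"] by (simp only: scale)
  qed
  have nonneg: "0 \<le> L" if "pl_path V E len p q L" for p q L
    using coord[OF that, of undefined] \<open>0 < c\<close>
    by (meson abs_ge_zero less_imp_le mult_nonneg_nonneg order_trans)
  have le: "?d p q \<le> L" if "pl_path V E len p q L" for p q L
    using that pl_path_tree_points[OF that] nonneg
    by (auto simp: path_dist_def intro!: cInf_lower bdd_belowI)
  have ge: "a \<le> ?d p q"
    if "p \<in> ?T" "q \<in> ?T" "\<And>L. pl_path V E len p q L \<Longrightarrow> a \<le> L" for p q a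
    using that conn[OF that(1,2)] by (auto simp: path_dist_def intro!: cInf_greatest)
  show ?thesis
  proof
    show "0 \<le> ?d p q" for p q
      using ge[of p q 0] nonneg by (cases "p \<in> ?T \<and> q \<in> ?T") (auto simp: path_dist_def)
    show "?d p q = ?d q p" for p q
    proof -
      have "pl_path V E len p q = pl_path V E len q p" by (auto intro: pl_path_sym)
      then show ?thesis by (simp add: path_dist_def)
    qed
    show "?d p q = 0 \<longleftrightarrow> p = q" if pq: "p \<in> ?T" "q \<in> ?T" for p q
    proof
      assume 0: "?d p q = 0"
      show "p = q"
      proof
        fix w
        have "c * \<bar>p w - q w\<bar> \<le> ?d p q" by (rule ge) (use pq coord in auto)
        with \<open>0 < c\<close> 0 show "p w = q w" by (simp add: mult_le_0_iff)
      qed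
    next
      assume "p = q"
      moreover have "0 \<le> ?d p q" by (rule ge) (use pq nonneg in auto)
      ultimately show "?d p q = 0" using le[OF pl_path.const[OF pq(1)]] by force
    qed
    show "?d p r \<le> ?d p q + ?d q r" if "p \<in> ?T" "q \<in> ?T" "r \<in> ?T" for p q r
    proof -
      have "?d p r - M \<le> ?d p q" if "pl_path V E len q r M" for M
      proof (rule ge)
        fix L assume "pl_path V E len p q L"
        from le[OF pl_path_trans[OF that this]] show "?d p r - M \<le> L" by simp
      qed fact+
      then have "?d p r - ?d p q \<le> ?d q r"
        using that by (intro ge) (auto simp: algebra_simps)
      then show ?thesis by simp
    qed
  qed
qed

section \<open>Stars\<close>

text \<open>The centre is \<open>None\<close>, so that an arbitrary set can serve as the set of leaves.\<close>

definition star_vertices :: "'a set \<Rightarrow> 'a option set" where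
  "star_vertices S = insert None (Some ` S)"

definition star_edges :: "'a set \<Rightarrow> 'a option set set" where
  "star_edges S = (\<lambda>s. {None, Some s}) ` S"

text \<open>Every edge contains the centre, and a path without repetitions visits the centre at most once.
  So it has at most three vertices, and if it has three then the centre is the middle one.\<close>

lemma simple_path_star_iff:
  assumes u: "u \<in> star_vertices S" and v: "v \<in> star_vertices S"
  shows "simple_path (star_vertices S) (star_edges S) u v p \<longleftrightarrow>
    p = (if u = v then [u] else if u = None \<or> v = None then [u, v] else [u, None, v])"
    (is "_ \<longleftrightarrow> p = ?c")
proof
  assume "simple_path (star_vertices S) (star_edges S) u v p"
  then have p: "p \<noteq> []" "hd p = u" "last p = v" "distinct p"
    and step: "\<And>i. Suc i < length p \<Longrightarrow> {p ! i, p ! Suc i} \<in> star_edges S"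
    by (auto simp: simple_path_def)
  have None: "p ! i = None \<or> p ! Suc i = None" if "Suc i < length p" for i
    using step[OF that] by (auto simp: star_edges_def doubleton_eq_iff)
  have "length p \<le> 3"
  proof (rule ccontr)
    assume "\<not> length p \<le> 3"
    then obtain a b c d xs where "p = a # b # c # d # xs"
      by (auto simp: not_le Suc_le_length_iff numeral_eq_Suc simp flip: Suc_le_eq)
    then show False using None[of 0] None[of 2] \<open>distinct p\<close> by (auto simp: numeral_eq_Suc)
  qed
  then consider (1) a where "p = [a]" | (2) a b where "p = [a, b]" | (3) a b c where "p = [a, b, c]"
    using \<open>p \<noteq> []\<close> by (auto simp: numeral_eq_Suc le_Suc_eq length_Suc_conv)
  then show "p = ?c"
  proof cases
    case (3 a b c)
    then have "b = None" using None[of 0] None[of 1] \<open>distinct p\<close> by auto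
    with 3 p show ?thesis by (cases c) auto
  qed (use p None[of 0] in auto)
next
  assume "p = ?c"
  then show "simple_path (star_vertices S) (star_edges S) u v p"
    using u v
    by (auto simp: simple_path_def star_vertices_def star_edges_def less_Suc_eq
        doubleton_eq_iff image_iff insert_commute split: if_splits)
qed

lemma combinatorial_tree_star: "combinatorial_tree (star_vertices S) (star_edges S)"
  unfolding combinatorial_tree_def
proof (intro conjI ballI)
  show "\<exists>!p. simple_path (star_vertices S) (star_edges S) u v p"
    if "u \<in> star_vertices S" "v \<in> star_vertices S" for u v
    using simple_path_star_iff[OF that] by auto
qed (auto simp: star_vertices_def star_edges_def)

lemma tree_points_star:
  "tree_points (star_vertices S) (star_edges S) =
    insert (indicator {None}) (\<Union>s\<in>S. closed_edge {None, Some s})"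
  by (auto simp: tree_points_def star_vertices_def star_edges_def
      intro: indicator_vertex_in_closed_edge)

lemma Metric_space_star:
  assumes "0 < l"
  shows "Metric_space (tree_points (star_vertices S) (star_edges S))
    (path_dist (star_vertices S) (star_edges S) (\<lambda>_. l))"
proof (rule Metric_space_path_dist)
  let ?pl = "pl_path (star_vertices S) (star_edges S) (\<lambda>_. l)"
  let ?T = "tree_points (star_vertices S) (star_edges S)"
  have centre: "\<exists>L. ?pl p (indicator {None}) L" if "p \<in> ?T" for p
  proof (cases "p = indicator {None}")
    case True
    then show ?thesis using that pl_path.const by blast
  next
    case False
    then obtain s where "s \<in> S" "p \<in> closed_edge {None, Some s}"
      using \<open>p \<in> ?T\<close> by (auto simp: tree_points_star)
    then show ?thesis
      using pl_path_edge[of "{None, Some s}" "star_edges S" p "indicator {None}"]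
        indicator_vertex_in_closed_edge[of "{None, Some s}" None]
      by (auto simp: star_edges_def)
  qed
  show "\<exists>L. ?pl p q L" if "p \<in> ?T" "q \<in> ?T" for p q
    using centre[OF that(1)] centre[OF that(2)] pl_path_trans pl_path_sym by blast
  show "card e = 2" if "e \<in> star_edges S" for e
    using that by (auto simp: star_edges_def)
qed (use assms in auto)

text \<open>The path through the centre has length \<open>2 * l\<close>. It is shortest because
  \<open>h p = l * (p s - p t)\<close> is 1-Lipschitz on edges, each edge seeing at most one of the two
  coordinates vary, and takes the values \<open>l\<close> and \<open>- l\<close> at the two leaves.\<close>

lemma path_dist_star_leaves:
  assumes "0 < l" and S: "s \<in> S" "t \<in> S" and "s \<noteq> t"
  shows "path_dist (star_vertices S) (star_edges S) (\<lambda>_. l) (indicator {Some s}) (indicator {Some t})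
    = 2 * l"
proof -
  let ?pl = "pl_path (star_vertices S) (star_edges S) (\<lambda>_. l)"
  let ?i = "\<lambda>v :: 'a option. indicator {v} :: 'a option \<Rightarrow> real"
  have arm: "?pl (?i (Some a)) (?i None) l" if "a \<in> S" for a
  proof -
    let ?e = "{None, Some a}"
    have in_e: "?i (Some a) \<in> closed_edge ?e" "?i None \<in> closed_edge ?e"
      by (auto intro: indicator_vertex_in_closed_edge)
    have "edge_dist (\<lambda>_. l) ?e (?i (Some a)) (?i None) = l"
      using edge_dist_eq_coordinate[OF _ in_e, of None] by simp
    then show ?thesis
      using pl_path_edge[OF _ in_e, of "star_edges S"] that by (metis image_eqI star_edges_def)
  qed
  have path: "?pl (?i (Some s)) (?i (Some t)) (2 * l)"
    using pl_path_trans[OF pl_path_sym[OF arm[OF S(2)]] arm[OF S(1)]] by simp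
  let ?h = "\<lambda>p :: 'a option \<Rightarrow> real. l * (p (Some s) - p (Some t))"
  have "\<bar>?h p - ?h q\<bar> \<le> edge_dist (\<lambda>_. l) e p q"
    if e_in: "e \<in> star_edges S" and pq: "p \<in> closed_edge e" "q \<in> closed_edge e" for e p q
  proof -
    obtain a where e: "e = {None, Some a}" using e_in by (auto simp: star_edges_def)
    have off: "p (Some b) = 0" "q (Some b) = 0" if "b \<noteq> a" for b
      using pq that by (auto simp: closed_edge_def e)
    have "\<bar>?h p - ?h q\<bar> = l * \<bar>(p (Some s) - p (Some t)) - (q (Some s) - q (Some t))\<bar>"
      using \<open>0 < l\<close> by (simp add: abs_mult flip: right_diff_distrib)
    also have "\<dots> \<le> l * \<bar>p (Some a) - q (Some a)\<bar>"
      using \<open>0 < l\<close> \<open>s \<noteq> t\<close> off[of s] off[of t]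
      by (intro mult_left_mono) (cases "a = s"; cases "a = t"; auto)+
    also have "\<dots> = edge_dist (\<lambda>_. l) e p q"
      using edge_dist_eq_coordinate[OF _ pq, of "Some a"] by (simp add: e)
    finally show ?thesis .
  qed
  then have short: "2 * l \<le> L" if "?pl (?i (Some s)) (?i (Some t)) L" for L
    using pl_path_lipschitz[OF that, of ?h] \<open>0 < l\<close> \<open>s \<noteq> t\<close> by simp
  have "Inf {L. ?pl (?i (Some s)) (?i (Some t)) L} = 2 * l"
    using path short by (intro cInf_eq_minimum) auto
  then show ?thesis using pl_path_tree_points[OF path] by (simp add: path_dist_def)
qed

section \<open>Balls embed coarsely into stars\<close>

theorem proposition3:
  fixes x0 :: "'a::metric_space"
  assumes "geodesic_space TYPE('a)"
  shows "\<forall>R>0. \<exists>(S :: 'a set) (V :: 'a option set) E len f.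
    dense_subset (sqrt R) S (cball x0 R) \<and>
    metric_tree V E len \<and>
    qi_embedding (sqrt R) (sqrt R) (sqrt R) (sqrt R)
      S dist (tree_points V E) (path_dist V E len) f"
proof (intro allI impI)
  fix R :: real assume "0 < R"
  define r where "r = sqrt R"
  have "0 < r" and R: "R = r * r" using \<open>0 < R\<close> by (simp_all add: r_def)
  obtain S where sep: "pairwise (\<lambda>x y. r \<le> dist x y) S" and dense: "dense_subset r S (cball x0 R)"
    using maximal_separated_subset \<open>0 < r\<close> by (metis less_imp_le)
  let ?V = "star_vertices S" and ?E = "star_edges S" and ?len = "\<lambda>_ :: 'a option set. R / 2"
  let ?f = "\<lambda>s. indicator {Some s} :: 'a option \<Rightarrow> real"
  let ?d = "path_dist ?V ?E ?len"
  have tree: "metric_tree ?V ?E ?len"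
    using combinatorial_tree_star \<open>0 < R\<close> by (auto simp: metric_tree_def)
  interpret T: Metric_space "tree_points ?V ?E" ?d
    by (rule Metric_space_star) (use \<open>0 < R\<close> in simp)
  have f: "?f s \<in> tree_points ?V ?E" if "s \<in> S" for s
    using that by (auto simp: tree_points_def star_vertices_def)
  have "1 / r * (dist x y - r) \<le> ?d (?f x) (?f y) \<and> ?d (?f x) (?f y) \<le> r * dist x y + r"
    if xy: "x \<in> S" "y \<in> S" for x y
  proof (cases "x = y")
    case True
    then show ?thesis using \<open>0 < r\<close> f[OF xy(2)] by simp
  next
    case False
    then have d: "?d (?f x) (?f y) = r * r"
      using path_dist_star_leaves[of "R / 2" x S y] xy \<open>0 < R\<close> R by simp
    have "r \<le> dist x y" using sep xy False by (simp add: pairwise_def)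
    then have "r * r \<le> r * dist x y + r" using \<open>0 < r\<close> by (simp add: add_increasing2)
    moreover have "dist x y \<le> 2 * (r * r)"
    proof -
      have "dist x0 x \<le> r * r" "dist x0 y \<le> r * r"
        using dense xy by (auto simp: dense_subset_def R)
      then show ?thesis using dist_triangle3[of x y x0] by linarith
    qed
    then have "1 / r * (dist x y - r) \<le> 2 * r - 1"
      using \<open>0 < r\<close> by (simp add: field_simps)
    moreover have "2 * r - 1 \<le> r * r"
      using zero_le_square[of "r - 1"] by (simp add: algebra_simps)
    ultimately show ?thesis unfolding d by linarith
  qed
  then have "qi_embedding r r r r S dist (tree_points ?V ?E) ?d ?f"
    using f T.Metric_space_axioms unfolding qi_embedding_def
    by (auto simp: Metric_space_def dist_commute dist_triangle)
  with dense tree show "\<exists>(S :: 'a set) (V :: 'a option set) E len f.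
    dense_subset (sqrt R) S (cball x0 R) \<and> metric_tree V E len \<and>
    qi_embedding (sqrt R) (sqrt R) (sqrt R) (sqrt R)
      S dist (tree_points V E) (path_dist V E len) f"
    unfolding r_def by blast
qed

end
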